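(* Let $U,V\subseteq\mathbb{R}^n$ be linear subspaces with $V\not\subset U$, let $T=P_VP_U$, let $v\in V$ and $\bar v=P_{U\cap V}(v)$. Either $T(v)=v$, in which case $v\in U\cap V$ and $C_T(v)=v=\bar v$; or $T(v)\ne v$ and $$C_T(v)=v+\mu_v\bigl(T(v)-v\bigr),\qquad \mu_v:=\frac{\operatorname{dist}^2(v,U)}{\|T(v)-v\|^2}.$$ In either case $C_T(v)\in V$.
   Context: For a linear subspace $W\subseteq\mathbb{R}^n$, $P_W$ is the orthogonal projection onto $W$, $R_W=2P_W-\mathrm{Id}$, and $\operatorname{dist}(x,W)=\|x-P_Wx\|$. Circumcenter: for a finite set $S\subset\mathbb{R}^n$ for which some point $q\in\mathbb{R}^n$ is equidistant from all elements of $S$, $\mathrm{circumcenter}(S):=P_{\mathrm{aff}(S)}(q)$, the orthogonal projection of $q$ onto the affine hull of $S$ (independent of the choice of $q$). The circumcentered--reflection operator is $C_T(x):=\mathrm{circumcenter}\{x,R_Ux,R_VR_Ux\}$ (any point of $U\cap V$ is equidistant from the three vertices). *)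

theory Defs
  imports "HOL-Analysis.Analysis"
begin

(* Orthogonal projection onto a nonempty affine subspace W. If W is a linear subspace, the
   condition on p is the usual "p \<in> W and x - p is orthogonal to W" (orth_proj_subspace_iff).
   For a W that is not affine and nonempty the value carries no meaning. *)
definition orth_proj :: "'a::euclidean_space set \<Rightarrow> 'a \<Rightarrow> 'a" where
  "orth_proj W x = (THE p. p \<in> W \<and> (\<forall>y\<in>W. orthogonal (x - p) (y - p)))"

definition reflection :: "'a::euclidean_space set \<Rightarrow> 'a \<Rightarrow> 'a" where
  "reflection W x = 2 *\<^sub>R orth_proj W x - x"

definition subspace_dist :: "'a::euclidean_space \<Rightarrow> 'a set \<Rightarrow> real" where
  "subspace_dist x W = norm (x - orth_proj W x)"

definition equidistant :: "'a::euclidean_space \<Rightarrow> 'a set \<Rightarrow> bool" where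
  "equidistant q S \<longleftrightarrow> (\<forall>s\<in>S. \<forall>t\<in>S. dist q s = dist q t)"

(* Meaningful only for nonempty S that has an equidistant point. The choice made by SOME
   is immaterial, see circumcenter_eq. *)
definition circumcenter :: "'a::euclidean_space set \<Rightarrow> 'a" where
  "circumcenter S = orth_proj (affine hull S) (SOME q. equidistant q S)"

(* The operator C_T of T = P_V P_U; it depends on the pair (U, V), not on T alone. *)
definition circumcentered_reflection ::
    "'a::euclidean_space set \<Rightarrow> 'a set \<Rightarrow> 'a \<Rightarrow> 'a" where
  "circumcentered_reflection U V x =
     circumcenter {x, reflection U x, reflection V (reflection U x)}"

lemma orth_proj_eqI:
  assumes "p \<in> W" and "\<And>y. y \<in> W \<Longrightarrow> orthogonal (x - p) (y - p)"
  shows "orth_proj W x = p"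
  unfolding orth_proj_def
proof (rule the_equality)
  show "p \<in> W \<and> (\<forall>y\<in>W. orthogonal (x - p) (y - p))" using assms by blast
next
  fix r assume r: "r \<in> W \<and> (\<forall>y\<in>W. orthogonal (x - r) (y - r))"
  have "(x - p) \<bullet> (r - p) = 0" "(x - r) \<bullet> (p - r) = 0"
    using assms r by (auto simp: orthogonal_def)
  then have "(r - p) \<bullet> (r - p) = 0"
    by (simp add: inner_diff_left inner_diff_right inner_commute)
  then show "r = p" by simp
qed

lemma closest_point_orthogonal:
  fixes W :: "'a::euclidean_space set"
  assumes "affine W" "W \<noteq> {}" "y \<in> W"
  shows "orthogonal (x - closest_point W x) (y - closest_point W x)"
proof -
  define p where "p = closest_point W x"
  have cl: "closed W" and cv: "convex W"
    using affine_closed[OF assms(1)] affine_imp_convex[OF assms(1)] .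
  have p: "p \<in> W" unfolding p_def using cl assms(2) by (rule closest_point_in_set)
  have "2 *\<^sub>R p + (- 1) *\<^sub>R y \<in> W" by (rule mem_affine[OF assms(1) p assms(3)]) simp
  then have "(x - p) \<bullet> (2 *\<^sub>R p + (- 1) *\<^sub>R y - p) \<le> 0"
    unfolding p_def by (rule closest_point_dot[OF cv cl])
  moreover have "2 *\<^sub>R p + (- 1) *\<^sub>R y - p = - (y - p)" by (simp add: scaleR_2)
  ultimately have "0 \<le> (x - p) \<bullet> (y - p)" by (simp only: inner_minus_right)
  moreover have "(x - p) \<bullet> (y - p) \<le> 0"
    unfolding p_def by (rule closest_point_dot[OF cv cl assms(3)])
  ultimately have "(x - p) \<bullet> (y - p) = 0" by linarith
  then show ?thesis unfolding orthogonal_def p_def .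
qed

lemma orth_proj_eq_closest_point:
  assumes "affine W" "W \<noteq> {}"
  shows "orth_proj W x = closest_point W x"
proof (rule orth_proj_eqI)
  show "closest_point W x \<in> W"
    using affine_closed[OF assms(1)] assms(2) by (rule closest_point_in_set)
qed (rule closest_point_orthogonal[OF assms])

lemma orth_proj_iff:
  assumes "affine W" "W \<noteq> {}"
  shows "orth_proj W x = p \<longleftrightarrow> p \<in> W \<and> (\<forall>y\<in>W. orthogonal (x - p) (y - p))"
proof
  assume "orth_proj W x = p"
  then have p: "p = closest_point W x" using orth_proj_eq_closest_point[OF assms] by simp
  have "p \<in> W" unfolding p
    using affine_closed[OF assms(1)] assms(2) by (rule closest_point_in_set)
  moreover have "orthogonal (x - p) (y - p)" if "y \<in> W" for y
    unfolding p using assms that by (rule closest_point_orthogonal)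
  ultimately show "p \<in> W \<and> (\<forall>y\<in>W. orthogonal (x - p) (y - p))" by blast
next
  assume "p \<in> W \<and> (\<forall>y\<in>W. orthogonal (x - p) (y - p))"
  then show "orth_proj W x = p" by (intro orth_proj_eqI) blast+
qed

lemma orth_proj_subspace_iff:
  assumes "subspace W"
  shows "orth_proj W x = p \<longleftrightarrow> p \<in> W \<and> (\<forall>y\<in>W. orthogonal (x - p) y)"
proof -
  have "affine W" "W \<noteq> {}" using assms subspace_imp_affine subspace_0 by blast+
  moreover have "(\<forall>y\<in>W. orthogonal (x - p) (y - p)) \<longleftrightarrow> (\<forall>y\<in>W. orthogonal (x - p) y)"
    if "p \<in> W"
  proof (rule iffI)
    assume *: "\<forall>y\<in>W. orthogonal (x - p) (y - p)"
    show "\<forall>y\<in>W. orthogonal (x - p) y"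
    proof (rule ballI)
      fix y assume "y \<in> W"
      then have "y + p \<in> W" using assms that by (simp add: subspace_add)
      then have "orthogonal (x - p) (y + p - p)" using * by blast
      then show "orthogonal (x - p) y" by simp
    qed
  next
    assume "\<forall>y\<in>W. orthogonal (x - p) y"
    then show "\<forall>y\<in>W. orthogonal (x - p) (y - p)"
      using subspace_diff[OF assms _ that] by blast
  qed
  ultimately show ?thesis by (simp add: orth_proj_iff cong: conj_cong)
qed

lemma circumcenter_eq:
  assumes "S \<noteq> {}" "equidistant q S"
  shows "circumcenter S = orth_proj (affine hull S) q"
proof -
  define r where "r = (SOME q. equidistant q S)"
  have r: "equidistant r S" unfolding r_def using assms(2) by (rule someI)
  let ?A = "affine hull S"
  obtain s where s: "s \<in> S" using assms(1) by blast
  have A: "affine ?A" "?A \<noteq> {}" using s by (auto simp: affine_affine_hull)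
  have "S \<subseteq> {y. (q - r) \<bullet> y = (q - r) \<bullet> s}"
  proof
    fix t assume t: "t \<in> S"
    have "dist q s = dist q t" "dist r s = dist r t"
      using assms(2) r s t unfolding equidistant_def by blast+
    then have "(dist q s)\<^sup>2 = (dist q t)\<^sup>2" "(dist r s)\<^sup>2 = (dist r t)\<^sup>2"
      by simp_all
    then show "t \<in> {y. (q - r) \<bullet> y = (q - r) \<bullet> s}"
      by (simp add: dist_norm power2_norm_eq_inner inner_diff_left inner_diff_right inner_commute)
  qed
  then have sub: "?A \<subseteq> {y. (q - r) \<bullet> y = (q - r) \<bullet> s}"
    by (rule hull_minimal) (rule affine_hyperplane)
  define p where "p = orth_proj ?A q"
  have p: "p \<in> ?A" "\<forall>y\<in>?A. orthogonal (q - p) (y - p)"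
    using iffD1[OF orth_proj_iff[OF A] p_def[symmetric]] by simp_all
  have "orth_proj ?A r = p"
  proof (rule orth_proj_eqI[OF p(1)])
    fix y assume y: "y \<in> ?A"
    have "(q - r) \<bullet> (y - p) = 0"
      using subsetD[OF sub y] subsetD[OF sub p(1)] by (simp add: inner_diff_right)
    moreover have "(q - p) \<bullet> (y - p) = 0" using p(2) y by (simp add: orthogonal_def)
    moreover have "(r - p) \<bullet> (y - p) = (q - p) \<bullet> (y - p) - (q - r) \<bullet> (y - p)"
      by (simp only: inner_diff_left[symmetric]) simp
    ultimately show "orthogonal (r - p) (y - p)" by (simp add: orthogonal_def)
  qed
  then show ?thesis unfolding circumcenter_def r_def[symmetric] p_def by simp
qed

end

theory Submission
  imports Defs
begin

text \<open>
  Write \<open>u = P\<^sub>U v\<close> and \<open>t = P\<^sub>V u = T v\<close>. A point of the affine hull of the triangle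
  with vertices \<open>v\<close>, \<open>R\<^sub>U v\<close>, \<open>R\<^sub>V (R\<^sub>U v)\<close> that is equidistant from the vertices is its
  circumcenter (\<open>circumcenter_eqI\<close>), so it is enough to find such a point. Points
  \<open>v + \<mu> (t - v)\<close> of the line through \<open>v\<close> and \<open>t\<close> are natural candidates. They lie in the hull,
  because \<open>t\<close> is the midpoint of \<open>v\<close> and the midpoint of the other two vertices
  (\<open>orth_proj_midpoint_reflections\<close>). They lie in \<open>V\<close>, so \<open>R\<^sub>V\<close> preserves their distances,
  and the last two vertices are equally far from them (\<open>dist_reflection_eq\<close>). There remains the
  condition that they are equally far from \<open>v\<close> and from \<open>R\<^sub>U v = v + 2 (u - v)\<close>, that is,
  \<open>\<mu> (t - v) \<bullet> (u - v) = (norm (u - v))\<^sup>2\<close>. As \<open>t - v\<close> is the projection of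
  \<open>u - v\<close> onto \<open>V\<close>, the inner product is \<open>(norm (t - v))\<^sup>2\<close>, and this determines \<open>\<mu>\<close>.

  If \<open>t = v\<close>, then \<open>u - v\<close> is orthogonal to \<open>V\<close>, hence to \<open>v\<close>, and also to \<open>u\<close>, so it is
  zero (\<open>fixed_point_alternating_projection\<close>). The triangle then degenerates to one point.
\<close>

lemma orth_proj_in:
  assumes "subspace W"
  shows "orth_proj W x \<in> W"
  using iffD1[OF orth_proj_subspace_iff[OF assms] refl] by blast

lemma orth_proj_residual:
  assumes "subspace W" and "y \<in> W"
  shows "(x - orth_proj W x) \<bullet> y = 0"
  using iffD1[OF orth_proj_subspace_iff[OF assms(1)] refl] assms(2)
  unfolding orthogonal_def by blast

lemma orth_proj_self:
  assumes "x \<in> W"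
  shows "orth_proj W x = x"
  using assms by (rule orth_proj_eqI) (simp add: orthogonal_def)

text \<open>
  The circumcenter may be computed from any equidistant point, in particular from one that lies
  in the affine hull and is therefore its own projection.
\<close>

lemma circumcenter_eqI:
  assumes "p \<in> affine hull S" and "equidistant p S"
  shows "circumcenter S = p"
proof -
  have "S \<noteq> {}" using assms(1) by auto
  then have "circumcenter S = orth_proj (affine hull S) p"
    using assms(2) by (rule circumcenter_eq)
  then show ?thesis using orth_proj_self[OF assms(1)] by simp
qed

text \<open>
  If \<open>x\<close> differs from \<open>P\<^sub>W x\<close>, the equation on the right describes the perpendicular bisector of
  \<open>x\<close> and its mirror image: it passes through their midpoint \<open>P\<^sub>W x\<close> and has the normal
  \<open>P\<^sub>W x - x\<close>.
\<close>

lemma dist_reflection_eq_iff: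
  "dist c (reflection W x) = dist c x \<longleftrightarrow>
     (c - x) \<bullet> (orth_proj W x - x) = (norm (orth_proj W x - x))\<^sup>2"
proof -
  have "c - reflection W x = (c - x) - 2 *\<^sub>R (orth_proj W x - x)"
    unfolding reflection_def by (simp add: scaleR_2)
  then have "dist c (reflection W x) = norm ((c - x) - 2 *\<^sub>R (orth_proj W x - x))"
    by (simp only: dist_norm)
  moreover have "(norm ((c - x) - 2 *\<^sub>R (orth_proj W x - x)))\<^sup>2 =
      (norm (c - x))\<^sup>2 - 4 * ((c - x) \<bullet> (orth_proj W x - x)) +
      4 * (norm (orth_proj W x - x))\<^sup>2" (is "_ = ?rhs")
    by (simp add: power2_norm_eq_inner inner_diff_left inner_diff_right inner_commute
        algebra_simps)
  ultimately have "(dist c (reflection W x))\<^sup>2 = ?rhs" by simp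
  moreover have "dist c (reflection W x) = dist c x \<longleftrightarrow>
      (dist c (reflection W x))\<^sup>2 = (dist c x)\<^sup>2"
    by simp
  ultimately show ?thesis by (auto simp: dist_norm)
qed

lemma dist_reflection_eq:
  assumes "subspace W" and "c \<in> W"
  shows "dist c (reflection W x) = dist c x"
proof -
  have "(x - orth_proj W x) \<bullet> (c - orth_proj W x) = 0"
    by (intro orth_proj_residual assms subspace_diff orth_proj_in)
  then show ?thesis
    unfolding dist_reflection_eq_iff power2_norm_eq_inner
    by (simp add: inner_diff_left inner_diff_right inner_commute)
qed

text \<open>
  For \<open>v \<in> V\<close>, linearity of \<open>P\<^sub>V\<close> gives \<open>P\<^sub>V (R\<^sub>U v) = 2 P\<^sub>V (P\<^sub>U v) - v\<close>, and the left side is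
  the midpoint of \<open>R\<^sub>U v\<close> and \<open>R\<^sub>V (R\<^sub>U v)\<close>.
\<close>

lemma orth_proj_midpoint_reflections:
  assumes V: "subspace V" and v: "v \<in> V"
  shows "orth_proj V (orth_proj U v) =
    (1/2) *\<^sub>R v + (1/4) *\<^sub>R reflection U v + (1/4) *\<^sub>R reflection V (reflection U v)"
proof -
  define u where "u = orth_proj U v"
  define t where "t = orth_proj V u"
  have "orth_proj V (reflection U v) = 2 *\<^sub>R t - v"
  proof (subst orth_proj_subspace_iff[OF V], intro conjI ballI)
    show "2 *\<^sub>R t - v \<in> V"
      unfolding t_def by (intro subspace_diff subspace_scale orth_proj_in V v)
  next
    fix y assume "y \<in> V"
    then have "(u - t) \<bullet> y = 0" unfolding t_def by (rule orth_proj_residual[OF V])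
    moreover have "reflection U v - (2 *\<^sub>R t - v) = 2 *\<^sub>R (u - t)"
      unfolding reflection_def u_def by (simp add: scaleR_diff_right)
    ultimately show "orthogonal (reflection U v - (2 *\<^sub>R t - v)) y"
      by (simp add: orthogonal_def)
  qed
  then have "reflection V (reflection U v) = 2 *\<^sub>R (2 *\<^sub>R t - v) - reflection U v"
    by (simp add: reflection_def)
  then have "(1/2) *\<^sub>R v + (1/4) *\<^sub>R reflection U v +
      (1/4) *\<^sub>R reflection V (reflection U v) = t"
    by (simp add: scaleR_diff_right)
  then show ?thesis by (simp only: t_def u_def)
qed

lemma fixed_point_alternating_projection:
  assumes U: "subspace U" and V: "subspace V" and fixed: "orth_proj V (orth_proj U v) = v"
  shows "orth_proj U v = v"
proof -
  let ?u = "orth_proj U v"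
  have "v \<in> V" using orth_proj_in[OF V, of ?u] fixed by simp
  then have "(?u - v) \<bullet> v = 0" using orth_proj_residual[OF V, of v ?u] fixed by simp
  moreover have "(v - ?u) \<bullet> ?u = 0" by (rule orth_proj_residual[OF U orth_proj_in[OF U]])
  ultimately have "(?u - v) \<bullet> (?u - v) = 0"
    by (simp add: inner_diff_left inner_diff_right)
  then show ?thesis by simp
qed

lemma inner_orth_proj_diff:
  assumes V: "subspace V" and v: "v \<in> V"
  shows "(orth_proj V x - v) \<bullet> (x - v) = (norm (orth_proj V x - v))\<^sup>2"
proof -
  have "(x - orth_proj V x) \<bullet> (orth_proj V x - v) = 0"
    by (intro orth_proj_residual V v subspace_diff orth_proj_in)
  moreover have "x - v = (x - orth_proj V x) + (orth_proj V x - v)" by simp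
  ultimately show ?thesis
    unfolding power2_norm_eq_inner
    by (metis add_0 inner_add_left inner_commute)
qed

lemma circumcentered_reflection_formula:
  assumes V: "subspace V" and v: "v \<in> V"
    and nz: "orth_proj V (orth_proj U v) \<noteq> v"
  shows "circumcentered_reflection U V v =
    v + ((subspace_dist v U)\<^sup>2 / (norm (orth_proj V (orth_proj U v) - v))\<^sup>2) *\<^sub>R
      (orth_proj V (orth_proj U v) - v)"
proof -
  define u where "u = orth_proj U v"
  define t where "t = orth_proj V u"
  define \<mu> where "\<mu> = (norm (u - v))\<^sup>2 / (norm (t - v))\<^sup>2"
  define c where "c = v + \<mu> *\<^sub>R (t - v)"
  let ?r = "reflection U v"
  let ?w = "reflection V ?r"
  have hull: "c \<in> affine hull {v, ?r, ?w}"
  proof -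
    have "(1/2) + (1/4) + (1/4) = (1::real)" by simp
    then have "t \<in> affine hull {v, ?r, ?w}"
      unfolding t_def u_def orth_proj_midpoint_reflections[OF V v] affine_hull_3
      by blast
    moreover have "v \<in> affine hull {v, ?r, ?w}" by (simp add: hull_inc)
    moreover have "c = (1 - \<mu>) *\<^sub>R v + \<mu> *\<^sub>R t"
      unfolding c_def by (simp add: algebra_simps)
    ultimately show ?thesis by (simp add: mem_affine affine_affine_hull)
  qed
  have "c \<in> V"
    unfolding c_def t_def
    by (intro subspace_add subspace_scale subspace_diff orth_proj_in V v)
  then have w: "dist c ?w = dist c ?r" by (rule dist_reflection_eq[OF V])
  have "(c - v) \<bullet> (u - v) = \<mu> * (norm (t - v))\<^sup>2"
    using inner_orth_proj_diff[OF V v, of u] by (simp add: c_def t_def)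
  also have "\<dots> = (norm (u - v))\<^sup>2" using nz by (simp add: \<mu>_def t_def u_def)
  finally have "dist c ?r = dist c v" by (simp add: dist_reflection_eq_iff u_def)
  with w have "equidistant c {v, ?r, ?w}" by (simp add: equidistant_def)
  with hull have "circumcentered_reflection U V v = c"
    unfolding circumcentered_reflection_def by (rule circumcenter_eqI)
  then show ?thesis
    by (simp add: c_def \<mu>_def t_def u_def subspace_dist_def norm_minus_commute)
qed

lemma circumcentered_reflection_self:
  assumes "v \<in> U" and "v \<in> V"
  shows "circumcentered_reflection U V v = v"
proof -
  have "reflection U v = v" "reflection V v = v"
    using assms by (simp_all add: reflection_def orth_proj_self scaleR_2)
  then have "circumcentered_reflection U V v = circumcenter {v}"
    by (simp add: circumcentered_reflection_def)
  also have "\<dots> = v" by (rule circumcenter_eqI) (simp_all add: equidistant_def)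
  finally show ?thesis .
qed

theorem theorem3p4:
  fixes U V :: "(real ^ 'n) set" and T :: "real ^ 'n \<Rightarrow> real ^ 'n"
    and v vbar :: "real ^ 'n"
  assumes "subspace U" and "subspace V" and "\<not> V \<subseteq> U"
    and "T = orth_proj V \<circ> orth_proj U"
    and "v \<in> V" and "vbar = orth_proj (U \<inter> V) v"
  shows "((T v = v \<and> v \<in> U \<inter> V \<and>
            circumcentered_reflection U V v = v \<and> v = vbar) \<or>
          (T v \<noteq> v \<and>
            circumcentered_reflection U V v =
              v + ((subspace_dist v U)\<^sup>2 / (norm (T v - v))\<^sup>2) *\<^sub>R (T v - v))) \<and>
         circumcentered_reflection U V v \<in> V"
proof (cases "T v = v")
  case True
  then have "orth_proj U v = v"
    using fixed_point_alternating_projection[OF assms(1,2)] assms(4) by simp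
  then have "v \<in> U" using orth_proj_in[OF assms(1), of v] by simp
  then have "circumcentered_reflection U V v = v" and "vbar = v"
    using assms(5,6) by (simp_all add: circumcentered_reflection_self orth_proj_self)
  then show ?thesis using True \<open>v \<in> U\<close> assms(5) by simp
next
  case False
  have Tv: "T v = orth_proj V (orth_proj U v)" using assms(4) by simp
  then have C: "circumcentered_reflection U V v =
      v + ((subspace_dist v U)\<^sup>2 / (norm (T v - v))\<^sup>2) *\<^sub>R (T v - v)"
    using circumcentered_reflection_formula[OF assms(2,5)] False by simp
  moreover have "circumcentered_reflection U V v \<in> V"
    unfolding C Tv by (intro subspace_add subspace_scale subspace_diff orth_proj_in assms(2,5))
  ultimately show ?thesis using False by blast
qed

end
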